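(* Let $R$ be a ring with a ring endomorphism $\sigma$, $\sigma(1)=1$, $\sigma\neq 0$, $\sigma\neq \mathrm{id}_R$, such that $\sigma^{t}=\mathrm{id}_R$ for some positive integer $t$. Let $\bar\sigma$ be the endomorphism of the polynomial ring $R[x]$ given by $\bar\sigma\left(\sum_{i=0}^m a_ix^i\right)=\sum_{i=0}^m\sigma(a_i)x^i$. Then $R$ is strongly $\sigma$-symmetric if and only if $R[x]$ is strongly $\bar\sigma$-symmetric.
   Context: Rings are associative with identity, not necessarily commutative. For a ring $T$ and a ring endomorphism $\tau$ of $T$ with $\tau(1)=1$, the skew polynomial ring $T[y;\tau]$ consists of polynomials $\sum a_i y^i$ with $a_i\in T$, usual addition, and multiplication determined by $yr=\tau(r)y$ for $r\in T$. A ring is symmetric if $abc=0$ implies $acb=0$ for all elements $a,b,c$. $T$ is strongly $\tau$-symmetric if $T[y;\tau]$ is symmetric. In $R[x]$ the indeterminate $x$ commutes with the elements of $R$. *)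

theory Defs
  imports "HOL-Algebra.UnivPoly"
begin

text \<open>
  The skew polynomial ring \<open>R[y;\<tau>]\<close>.  It has the elements, addition, zero, one and monomials
  of \<^const>\<open>UP\<close> (which only needs \<open>R\<close> to be a ring, not a commutative one), with coefficients
  written on the left of the powers of \<open>y\<close>.  The rule \<open>y r = \<tau>(r) y\<close> gives
  \<open>(a y\<^sup>i) (b y\<^sup>j) = a \<tau>\<^sup>i(b) y\<^sup>i\<^sup>+\<^sup>j\<close>, whence the product below; see
  \<open>skew_UP_ring\<close> and \<open>skew_UP_commutation\<close>.
\<close>

definition skew_UP :: "('a, 'm) ring_scheme \<Rightarrow> ('a \<Rightarrow> 'a) \<Rightarrow> ('a, nat \<Rightarrow> 'a) up_ring"
  where "skew_UP R \<tau> = (UP R)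
    \<lparr>mult := (\<lambda>p\<in>up R. \<lambda>q\<in>up R. \<lambda>n. \<Oplus>\<^bsub>R\<^esub>i \<in> {..n}. p i \<otimes>\<^bsub>R\<^esub> (\<tau> ^^ i) (q (n - i)))\<rparr>"

text \<open>To be applied to structures satisfying \<^locale>\<open>ring\<close>.\<close>

definition symmetric_ring :: "('a, 'm) ring_scheme \<Rightarrow> bool"
  where "symmetric_ring R \<longleftrightarrow>
    (\<forall>a\<in>carrier R. \<forall>b\<in>carrier R. \<forall>c\<in>carrier R.
       a \<otimes>\<^bsub>R\<^esub> b \<otimes>\<^bsub>R\<^esub> c = \<zero>\<^bsub>R\<^esub> \<longrightarrow> a \<otimes>\<^bsub>R\<^esub> c \<otimes>\<^bsub>R\<^esub> b = \<zero>\<^bsub>R\<^esub>)"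

definition strongly_symmetric :: "('a, 'm) ring_scheme \<Rightarrow> ('a \<Rightarrow> 'a) \<Rightarrow> bool"
  where "strongly_symmetric R \<tau> \<longleftrightarrow> symmetric_ring (skew_UP R \<tau>)"

text \<open>
  The coefficientwise extension of a map to polynomials; elements of \<^term>\<open>UP R\<close> are
  represented by their coefficient functions.
\<close>

definition UP_map :: "('a \<Rightarrow> 'a) \<Rightarrow> (nat \<Rightarrow> 'a) \<Rightarrow> nat \<Rightarrow> 'a"
  where "UP_map \<sigma> p = (\<lambda>i. \<sigma> (p i))"


locale ring_endo =
  fixes R (structure) and \<tau> :: "'a \<Rightarrow> 'a"
  assumes ring_R: "ring R" and endo: "\<tau> \<in> ring_hom R R"

sublocale ring_endo \<subseteq> R?: ring R by (rule ring_R)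

context ring_endo
begin

lemma tau_zero [simp]: "\<tau> \<zero> = \<zero>"
  by (rule ring_hom_zero [OF endo ring_R ring_R])

lemma tau_pow_hom: "\<tau> ^^ i \<in> ring_hom R R"
proof (induction i)
  case 0
  show ?case by (simp add: ring_hom_def)
next
  case (Suc i)
  then show ?case using endo by (auto simp: ring_hom_def Pi_def)
qed

lemma tau_pow_closed [simp, intro]: "a \<in> carrier R \<Longrightarrow> (\<tau> ^^ i) a \<in> carrier R"
  by (rule ring_hom_closed [OF tau_pow_hom])

lemma tau_pow_mult: "a \<in> carrier R \<Longrightarrow> b \<in> carrier R \<Longrightarrow>
    (\<tau> ^^ i) (a \<otimes> b) = (\<tau> ^^ i) a \<otimes> (\<tau> ^^ i) b"
  by (rule ring_hom_mult [OF tau_pow_hom])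

lemma tau_pow_add: "a \<in> carrier R \<Longrightarrow> b \<in> carrier R \<Longrightarrow>
    (\<tau> ^^ i) (a \<oplus> b) = (\<tau> ^^ i) a \<oplus> (\<tau> ^^ i) b"
  by (rule ring_hom_add [OF tau_pow_hom])

lemma tau_pow_zero [simp]: "(\<tau> ^^ i) \<zero> = \<zero>"
  by (rule ring_hom_zero [OF tau_pow_hom ring_R ring_R])

lemma tau_pow_one [simp]: "(\<tau> ^^ i) \<one> = \<one>"
  by (rule ring_hom_one [OF tau_pow_hom])

lemma tau_pow_finsum:
  assumes "finite A" "f \<in> A \<rightarrow> carrier R"
  shows "(\<tau> ^^ i) (finsum R f A) = (\<Oplus>k\<in>A. (\<tau> ^^ i) (f k))"
  using assms
proof (induction A rule: finite_induct)
  case (insert x F)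
  then have "finsum R f F \<in> carrier R" by (intro finsum_closed) auto
  with insert show ?case by (simp add: Pi_def tau_pow_add)
qed simp

interpretation U: UP_ring R "UP R"
  by unfold_locales

lemma skew_UP_simps [simp]:
  "carrier (skew_UP R \<tau>) = up R"
  "add (skew_UP R \<tau>) = add (UP R)"
  "zero (skew_UP R \<tau>) = zero (UP R)"
  "one (skew_UP R \<tau>) = one (UP R)"
  "monom (skew_UP R \<tau>) = monom (UP R)"
  by (simp_all add: skew_UP_def UP_def)

lemma skew_mult_eq: "p \<in> up R \<Longrightarrow> q \<in> up R \<Longrightarrow>
    p \<otimes>\<^bsub>skew_UP R \<tau>\<^esub> q = (\<lambda>n. \<Oplus>i \<in> {..n}. p i \<otimes> (\<tau> ^^ i) (q (n - i)))"
  by (simp add: skew_UP_def)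

lemma skew_mult_closed:
  assumes p: "p \<in> up R" and q: "q \<in> up R"
  shows "p \<otimes>\<^bsub>skew_UP R \<tau>\<^esub> q \<in> up R"
proof -
  from p obtain n where n: "bound \<zero> n p" by fast
  from q obtain m where m: "bound \<zero> m q" by fast
  have "(\<Oplus>i \<in> {..k}. p i \<otimes> (\<tau> ^^ i) (q (k - i))) = \<zero>" if k: "n + m < k" for k
  proof -
    have "p i \<otimes> (\<tau> ^^ i) (q (k - i)) = \<zero>" for i
    proof (cases "n < i")
      case True
      with n p q show ?thesis by (auto simp: mem_upD)
    next
      case False
      with k have "m < k - i" by arith
      with m have "q (k - i) = \<zero>" by auto
      with p show ?thesis by (simp add: mem_upD)
    qed
    then show ?thesis by (simp add: Pi_def)
  qed
  then have "bound \<zero> (n + m) (p \<otimes>\<^bsub>skew_UP R \<tau>\<^esub> q)"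
    by (auto simp: skew_mult_eq p q)
  moreover have "(p \<otimes>\<^bsub>skew_UP R \<tau>\<^esub> q) k \<in> carrier R" for k
    using p q by (auto simp: skew_mult_eq mem_upD intro!: finsum_closed)
  ultimately show ?thesis by blast
qed

lemma skew_assoc_aux:
  assumes R: "a \<in> UNIV \<rightarrow> carrier R" "\<And>i. b i \<in> UNIV \<rightarrow> carrier R" "c \<in> UNIV \<rightarrow> carrier R"
  shows "(\<Oplus>j \<in> {..k::nat}. (\<Oplus>i \<in> {..j}. a i \<otimes> b i (j - i)) \<otimes> c j) =
    (\<Oplus>j \<in> {..k}. a j \<otimes> (\<Oplus>i \<in> {..k - j}. b j i \<otimes> c (j + i)))"
proof (induction k)
  case 0
  then show ?case using R by (simp add: Pi_def m_assoc)
next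
  case (Suc k)
  with R show ?case
    by (simp cong: finsum_cong add: Suc_diff_le Pi_def l_distr r_distr m_assoc)
       (simp cong: finsum_cong add: Pi_def a_ac finsum_ldistr m_assoc)
qed

lemma skew_assoc:
  assumes p: "p \<in> up R" and q: "q \<in> up R" and r: "r \<in> up R"
  shows "p \<otimes>\<^bsub>skew_UP R \<tau>\<^esub> q \<otimes>\<^bsub>skew_UP R \<tau>\<^esub> r = p \<otimes>\<^bsub>skew_UP R \<tau>\<^esub> (q \<otimes>\<^bsub>skew_UP R \<tau>\<^esub> r)"
proof
  fix n
  have "(p \<otimes>\<^bsub>skew_UP R \<tau>\<^esub> (q \<otimes>\<^bsub>skew_UP R \<tau>\<^esub> r)) n =
    (\<Oplus>j \<in> {..n}. p j \<otimes> (\<tau> ^^ j) (\<Oplus>i \<in> {..n - j}. q i \<otimes> (\<tau> ^^ i) (r (n - j - i))))"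
    using skew_mult_closed [OF q r] by (simp add: skew_mult_eq p q r)
  also have "\<dots> = (\<Oplus>j \<in> {..n}. p j \<otimes>
      (\<Oplus>i \<in> {..n - j}. (\<tau> ^^ j) (q i) \<otimes> (\<tau> ^^ (j + i)) (r (n - (j + i)))))"
    using p q r
    by (intro finsum_cong')
       (auto simp: tau_pow_finsum Pi_def mem_upD tau_pow_mult funpow_add
         intro!: finsum_closed m_closed)
  also have "\<dots> = (p \<otimes>\<^bsub>skew_UP R \<tau>\<^esub> q \<otimes>\<^bsub>skew_UP R \<tau>\<^esub> r) n"
    using skew_assoc_aux [of p "\<lambda>i k. (\<tau> ^^ i) (q k)" "\<lambda>j. (\<tau> ^^ j) (r (n - j))" n]
      skew_mult_closed [OF p q] p q r
    by (simp add: skew_mult_eq Pi_def mem_upD)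
  finally show "(p \<otimes>\<^bsub>skew_UP R \<tau>\<^esub> q \<otimes>\<^bsub>skew_UP R \<tau>\<^esub> r) n = (p \<otimes>\<^bsub>skew_UP R \<tau>\<^esub> (q \<otimes>\<^bsub>skew_UP R \<tau>\<^esub> r)) n"
    by simp
qed

lemma UP_proj:
  "carrier (UP R) = up R"
  "p \<in> up R \<Longrightarrow> q \<in> up R \<Longrightarrow> p \<oplus>\<^bsub>UP R\<^esub> q = (\<lambda>i. p i \<oplus> q i)"
  "\<one>\<^bsub>UP R\<^esub> = (\<lambda>i. if i = 0 then \<one> else \<zero>)"
  "a \<in> carrier R \<Longrightarrow> monom (UP R) a n = (\<lambda>i. if i = n then a else \<zero>)"
  by (simp_all add: UP_def)

lemma up_one: "(\<lambda>i. if i = 0 then \<one> else \<zero>) \<in> up R"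
  by (rule up_one_closed)

lemma monom_skew_mult:
  assumes a: "a \<in> carrier R" and q: "q \<in> up R"
  shows "(\<lambda>i. if i = m then a else \<zero>) \<otimes>\<^bsub>skew_UP R \<tau>\<^esub> q =
    (\<lambda>n. if m \<le> n then a \<otimes> (\<tau> ^^ m) (q (n - m)) else \<zero>)"
proof
  fix n
  have up: "(\<lambda>i. if i = m then a else \<zero>) \<in> up R"
    using U.monom_closed [OF a, of m] a by (simp add: UP_proj)
  have "((\<lambda>i. if i = m then a else \<zero>) \<otimes>\<^bsub>skew_UP R \<tau>\<^esub> q) n
      = (\<Oplus>i \<in> {..n}. if m = i then a \<otimes> (\<tau> ^^ i) (q (n - i)) else \<zero>)"
    using a q by (auto simp: skew_mult_eq up mem_upD intro!: finsum_cong')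
  also have "\<dots> = (if m \<le> n then a \<otimes> (\<tau> ^^ m) (q (n - m)) else \<zero>)"
  proof (cases "m \<le> n")
    case True
    then show ?thesis
      using a q finsum_singleton [of m "{..n}" "\<lambda>i. a \<otimes> (\<tau> ^^ i) (q (n - i))"]
      by (simp add: Pi_def mem_upD)
  next
    case False
    then have "(\<Oplus>i \<in> {..n}. if m = i then a \<otimes> (\<tau> ^^ i) (q (n - i)) else \<zero>) = (\<Oplus>i \<in> {..n}. \<zero>)"
      by (intro finsum_cong') auto
    with False show ?thesis by simp
  qed
  finally show "((\<lambda>i. if i = m then a else \<zero>) \<otimes>\<^bsub>skew_UP R \<tau>\<^esub> q) n =
    (if m \<le> n then a \<otimes> (\<tau> ^^ m) (q (n - m)) else \<zero>)" .
qed

lemma skew_UP_monom_mult: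
  assumes "a \<in> carrier R" "b \<in> carrier R"
  shows "monom (skew_UP R \<tau>) a i \<otimes>\<^bsub>skew_UP R \<tau>\<^esub> monom (skew_UP R \<tau>) b j =
    monom (skew_UP R \<tau>) (a \<otimes> (\<tau> ^^ i) b) (i + j)"
proof -
  have "(\<lambda>k. if k = j then b else \<zero>) \<in> up R"
    using U.monom_closed [OF assms(2), of j] assms by (simp add: UP_proj)
  with assms show ?thesis
    by (auto simp: UP_proj monom_skew_mult fun_eq_iff)
qed

theorem skew_UP_commutation:
  assumes "r \<in> carrier R"
  shows "monom (skew_UP R \<tau>) \<one> 1 \<otimes>\<^bsub>skew_UP R \<tau>\<^esub> monom (skew_UP R \<tau>) r 0 =
    monom (skew_UP R \<tau>) (\<tau> r) 0 \<otimes>\<^bsub>skew_UP R \<tau>\<^esub> monom (skew_UP R \<tau>) \<one> 1"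
  using assms ring_hom_closed [OF endo assms] by (simp only: skew_UP_monom_mult one_closed) simp

theorem skew_UP_ring: "ring (skew_UP R \<tau>)"
proof (rule ringI)
  show "abelian_group (skew_UP R \<tau>)"
  proof (rule abelian_groupI)
    fix x assume "x \<in> carrier (skew_UP R \<tau>)"
    then show "\<exists>y\<in>carrier (skew_UP R \<tau>). y \<oplus>\<^bsub>skew_UP R \<tau>\<^esub> x = \<zero>\<^bsub>skew_UP R \<tau>\<^esub>"
      using U.P.l_neg [of x] U.P.a_inv_closed [of x] by (auto simp: UP_proj(1))
  qed (use U.P.a_assoc U.P.a_comm U.P.a_closed U.P.zero_closed U.P.l_zero in \<open>auto simp: UP_proj(1)\<close>)
  show "monoid (skew_UP R \<tau>)"
  proof (rule monoidI)
    fix p assume "p \<in> carrier (skew_UP R \<tau>)"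
    then have p: "p \<in> up R" by simp
    show "\<one>\<^bsub>skew_UP R \<tau>\<^esub> \<otimes>\<^bsub>skew_UP R \<tau>\<^esub> p = p"
      using p monom_skew_mult [of \<one> p 0] by (simp add: UP_proj mem_upD)
    show "p \<otimes>\<^bsub>skew_UP R \<tau>\<^esub> \<one>\<^bsub>skew_UP R \<tau>\<^esub> = p"
    proof
      fix n
      have "(p \<otimes>\<^bsub>skew_UP R \<tau>\<^esub> \<one>\<^bsub>skew_UP R \<tau>\<^esub>) n = (\<Oplus>i \<in> {..n}. if n = i then p i else \<zero>)"
        using p by (auto simp: skew_mult_eq UP_proj up_one mem_upD intro!: finsum_cong')
      also have "\<dots> = p n"
        using p finsum_singleton [of n "{..n}" p] by (simp add: Pi_def mem_upD)
      finally show "(p \<otimes>\<^bsub>skew_UP R \<tau>\<^esub> \<one>\<^bsub>skew_UP R \<tau>\<^esub>) n = p n" .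
    qed
  qed (auto simp: skew_mult_closed skew_assoc UP_proj up_one)
  fix p q r
  assume "p \<in> carrier (skew_UP R \<tau>)" "q \<in> carrier (skew_UP R \<tau>)" "r \<in> carrier (skew_UP R \<tau>)"
  then have pqr: "p \<in> up R" "q \<in> up R" "r \<in> up R" by auto
  show "(p \<oplus>\<^bsub>skew_UP R \<tau>\<^esub> q) \<otimes>\<^bsub>skew_UP R \<tau>\<^esub> r =
    p \<otimes>\<^bsub>skew_UP R \<tau>\<^esub> r \<oplus>\<^bsub>skew_UP R \<tau>\<^esub> q \<otimes>\<^bsub>skew_UP R \<tau>\<^esub> r"
    using pqr skew_mult_closed [OF pqr(1,3)] skew_mult_closed [OF pqr(2,3)] up_add_closed [OF pqr(1,2)]
    by (simp add: UP_proj skew_mult_eq l_distr mem_upD Pi_def)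
  show "r \<otimes>\<^bsub>skew_UP R \<tau>\<^esub> (p \<oplus>\<^bsub>skew_UP R \<tau>\<^esub> q) =
    r \<otimes>\<^bsub>skew_UP R \<tau>\<^esub> p \<oplus>\<^bsub>skew_UP R \<tau>\<^esub> r \<otimes>\<^bsub>skew_UP R \<tau>\<^esub> q"
    using pqr skew_mult_closed [OF pqr(3,1)] skew_mult_closed [OF pqr(3,2)] up_add_closed [OF pqr(1,2)]
    by (simp add: UP_proj skew_mult_eq r_distr tau_pow_add mem_upD Pi_def)
qed

theorem UP_map_hom: "UP_map \<tau> \<in> ring_hom (UP R) (UP R)"
proof (rule ring_hom_memI)
  have closed: "UP_map \<tau> p \<in> up R" if p: "p \<in> up R" for p
  proof -
    from p obtain n where "bound \<zero> n p" by fast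
    then have "bound \<zero> n (UP_map \<tau> p)" by (auto simp: UP_map_def)
    then show ?thesis using p ring_hom_closed [OF endo]
      by (auto simp: UP_map_def mem_upD intro!: mem_upI)
  qed
  then show "UP_map \<tau> p \<in> carrier (UP R)" if "p \<in> carrier (UP R)" for p
    using that by (simp add: UP_proj)
  fix p q assume "p \<in> carrier (UP R)" "q \<in> carrier (UP R)"
  then have pq: "p \<in> up R" "q \<in> up R" by (auto simp: UP_proj)
  show "UP_map \<tau> (p \<otimes>\<^bsub>UP R\<^esub> q) = UP_map \<tau> p \<otimes>\<^bsub>UP R\<^esub> UP_map \<tau> q"
  proof
    fix n
    have "UP_map \<tau> (p \<otimes>\<^bsub>UP R\<^esub> q) n = \<tau> (\<Oplus>i \<in> {..n}. p i \<otimes> q (n - i))"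
      using pq by (simp add: UP_def UP_map_def)
    also have "\<dots> = (\<Oplus>i \<in> {..n}. \<tau> (p i \<otimes> q (n - i)))"
      using tau_pow_finsum [of "{..n}" "\<lambda>i. p i \<otimes> q (n - i)" 1] pq by (simp add: Pi_def mem_upD)
    also have "\<dots> = (\<Oplus>i \<in> {..n}. \<tau> (p i) \<otimes> \<tau> (q (n - i)))"
      using pq ring_hom_closed [OF endo] ring_hom_mult [OF endo]
      by (intro finsum_cong') (auto simp: mem_upD)
    also have "\<dots> = (UP_map \<tau> p \<otimes>\<^bsub>UP R\<^esub> UP_map \<tau> q) n"
      using closed [OF pq(1)] closed [OF pq(2)] by (simp add: UP_def UP_map_def)
    finally show "UP_map \<tau> (p \<otimes>\<^bsub>UP R\<^esub> q) n = (UP_map \<tau> p \<otimes>\<^bsub>UP R\<^esub> UP_map \<tau> q) n" .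
  qed
  show "UP_map \<tau> (p \<oplus>\<^bsub>UP R\<^esub> q) = UP_map \<tau> p \<oplus>\<^bsub>UP R\<^esub> UP_map \<tau> q"
    using pq closed [OF pq(1)] closed [OF pq(2)] ring_hom_add [OF endo]
    by (auto simp: UP_proj UP_map_def mem_upD)
next
  show "UP_map \<tau> \<one>\<^bsub>UP R\<^esub> = \<one>\<^bsub>UP R\<^esub>"
    using ring_hom_one [OF endo] by (auto simp: UP_proj UP_map_def)
qed

end

end

theory Submission
  imports Defs
begin

text \<open>
  Since \<open>x\<close> is central, \<open>R[x][y;\<sigma>] = R[y;\<sigma>][x]\<close>, which contains \<open>R[y;\<sigma>]\<close> as the subring of
  polynomials constant in \<open>x\<close>; this gives one direction.  Conversely, \<open>y\<^sup>N\<close> is central in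
  \<open>R[y;\<sigma>]\<close> whenever \<open>t\<close> divides \<open>N\<close>, so \<open>x \<mapsto> y\<^sup>N\<close> defines a homomorphism
  \<open>R[x][y;\<sigma>] \<rightarrow> R[y;\<sigma>]\<close>.  It kills no nonzero element whose degree in \<open>y\<close> is less than \<open>N\<close>,
  hence a relation \<open>a c b = 0\<close> can be tested in \<open>R[y;\<sigma>]\<close> by taking \<open>N\<close> large.
\<close>

section \<open>Transfer of symmetry along separating multiplicative maps\<close>

text \<open>A relation \<open>abc = 0\<close> is pushed to \<open>T\<close>, where it yields
  \<open>acb = 0\<close>, and is then pulled back. Only the single element \<open>acb\<close> has to
  be recovered from its image, so the map may be chosen after \<open>a\<close>, \<open>b\<close>,
  \<open>c\<close> and depend on them.\<close>

lemma symmetric_ring_residual: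
  assumes "ring S" and T: "symmetric_ring T"
    and sep: "\<And>x. x \<in> carrier S \<Longrightarrow> \<exists>\<phi>\<in>carrier S \<rightarrow> carrier T.
      (\<forall>a\<in>carrier S. \<forall>b\<in>carrier S. \<phi> (a \<otimes>\<^bsub>S\<^esub> b) = \<phi> a \<otimes>\<^bsub>T\<^esub> \<phi> b) \<and>
      \<phi> \<zero>\<^bsub>S\<^esub> = \<zero>\<^bsub>T\<^esub> \<and> (\<phi> x = \<zero>\<^bsub>T\<^esub> \<longrightarrow> x = \<zero>\<^bsub>S\<^esub>)"
  shows "symmetric_ring S"
  unfolding symmetric_ring_def
proof (intro ballI impI)
  interpret S: ring S by fact
  fix a b c
  assume abc: "a \<in> carrier S" "b \<in> carrier S" "c \<in> carrier S"
    and eq: "a \<otimes>\<^bsub>S\<^esub> b \<otimes>\<^bsub>S\<^esub> c = \<zero>\<^bsub>S\<^esub>"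
  from abc have "a \<otimes>\<^bsub>S\<^esub> c \<otimes>\<^bsub>S\<^esub> b \<in> carrier S" by simp
  from sep [OF this] obtain \<phi> where \<phi>: "\<phi> \<in> carrier S \<rightarrow> carrier T"
    and mult: "\<And>a b. a \<in> carrier S \<Longrightarrow> b \<in> carrier S \<Longrightarrow> \<phi> (a \<otimes>\<^bsub>S\<^esub> b) = \<phi> a \<otimes>\<^bsub>T\<^esub> \<phi> b"
    and zero: "\<phi> \<zero>\<^bsub>S\<^esub> = \<zero>\<^bsub>T\<^esub>"
    and inj: "\<phi> (a \<otimes>\<^bsub>S\<^esub> c \<otimes>\<^bsub>S\<^esub> b) = \<zero>\<^bsub>T\<^esub> \<Longrightarrow> a \<otimes>\<^bsub>S\<^esub> c \<otimes>\<^bsub>S\<^esub> b = \<zero>\<^bsub>S\<^esub>"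
    by blast
  have "\<phi> a \<otimes>\<^bsub>T\<^esub> \<phi> b \<otimes>\<^bsub>T\<^esub> \<phi> c = \<zero>\<^bsub>T\<^esub>"
    using abc zero by (simp add: eq flip: mult)
  with T \<phi> abc have "\<phi> a \<otimes>\<^bsub>T\<^esub> \<phi> c \<otimes>\<^bsub>T\<^esub> \<phi> b = \<zero>\<^bsub>T\<^esub>"
    unfolding symmetric_ring_def by (metis funcset_mem)
  with abc inj show "a \<otimes>\<^bsub>S\<^esub> c \<otimes>\<^bsub>S\<^esub> b = \<zero>\<^bsub>S\<^esub>"
    by (simp add: mult)
qed

section \<open>Iterated finite sums and products of sums\<close>

lemma (in abelian_monoid) finsum_Sigma:
  assumes "finite A" "\<And>a. a \<in> A \<Longrightarrow> finite (B a)"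
    and f: "\<And>a b. a \<in> A \<Longrightarrow> b \<in> B a \<Longrightarrow> f a b \<in> carrier G"
  shows "(\<Oplus>a\<in>A. \<Oplus>b\<in>B a. f a b) = (\<Oplus>z\<in>Sigma A B. case z of (a, b) \<Rightarrow> f a b)"
proof -
  \<comment> \<open>Tagging each fibre by \<open>Pair a\<close> makes the fibres disjoint, so the
    sum over their union splits.\<close>
  have "(\<Oplus>z\<in>Sigma A B. case z of (a, b) \<Rightarrow> f a b) = (\<Oplus>x\<in>(\<Union>a\<in>A. Pair a ` B a). case x of (a, b) \<Rightarrow> f a b)"
    by (rule arg_cong [where f = "finsum G _"]) auto
  also have "\<dots> = (\<Oplus>a\<in>A. \<Oplus>x\<in>Pair a ` B a. case x of (a, b) \<Rightarrow> f a b)"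
    using assms by (intro add.finprod_UN_disjoint) (auto simp: pairwise_def disjnt_def)
  also have "\<dots> = (\<Oplus>a\<in>A. \<Oplus>b\<in>B a. f a b)"
  proof (rule finsum_cong')
    fix a assume a: "a \<in> A"
    show "(\<Oplus>x\<in>Pair a ` B a. case x of (a, b) \<Rightarrow> f a b) = (\<Oplus>b\<in>B a. f a b)"
      using f a by (subst finsum_reindex) (auto simp: inj_on_def)
  qed (auto intro!: finsum_closed f)
  finally show ?thesis by simp
qed

lemma (in abelian_monoid) finsum_reindex_bij_betw:
  assumes "bij_betw h A B" "\<And>b. b \<in> B \<Longrightarrow> f b \<in> carrier G"
  shows "(\<Oplus>a\<in>A. f (h a)) = (\<Oplus>b\<in>B. f b)"
  using assms finsum_reindex [of f h A] by (auto simp: bij_betw_def)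

lemma (in ring) finsum_mult_finsum:
  assumes "finite A" "finite B" "f \<in> A \<rightarrow> carrier R" "g \<in> B \<rightarrow> carrier R"
  shows "(\<Oplus>a\<in>A. f a) \<otimes> (\<Oplus>b\<in>B. g b) = (\<Oplus>z\<in>A \<times> B. case z of (a, b) \<Rightarrow> f a \<otimes> g b)"
proof -
  have "(\<Oplus>a\<in>A. f a) \<otimes> (\<Oplus>b\<in>B. g b) = (\<Oplus>a\<in>A. f a \<otimes> (\<Oplus>b\<in>B. g b))"
    using assms by (intro finsum_ldistr finsum_closed) auto
  also have "\<dots> = (\<Oplus>a\<in>A. \<Oplus>b\<in>B. f a \<otimes> g b)"
    using assms by (intro finsum_cong' finsum_rdistr) (auto intro!: finsum_closed)
  finally show ?thesis
    using assms finsum_Sigma [of A "\<lambda>_. B" "\<lambda>a b. f a \<otimes> g b"] by (auto simp: Pi_def)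
qed

section \<open>Coefficients of polynomials in two indeterminates\<close>

lemma UP_map_funpow: "UP_map \<tau> ^^ i = UP_map (\<tau> ^^ i)"
  by (induction i) (auto simp: UP_map_def fun_eq_iff)

context ring
begin

lemma UP_finsum_apply:
  assumes "finite A" "p \<in> A \<rightarrow> up R"
  shows "finsum (UP R) p A k = (\<Oplus>i\<in>A. p i k)"
proof -
  interpret U: UP_ring R "UP R" by unfold_locales
  have carr: "carrier (UP R) = up R" by (simp add: UP_def)
  have coeff: "coeff (UP R) q k = q k" if "q \<in> up R" for q using that by (simp add: UP_def)
  have "finsum (UP R) p A \<in> up R"
    using assms U.P.finsum_closed [of p A] by (simp add: carr)
  then have "finsum (UP R) p A k = (\<Oplus>i\<in>A. coeff (UP R) (p i) k)"
    using U.coeff_finsum [OF assms(1), of p k] assms by (simp add: carr coeff)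
  also have "\<dots> = (\<Oplus>i\<in>A. p i k)"
    using assms by (intro finsum_cong') (auto simp: coeff Pi_def mem_upD)
  finally show ?thesis .
qed

lemma up_UP_coeff:
  assumes "F \<in> up (UP R)"
  shows "F j \<in> up R" "F j i \<in> carrier R"
  using mem_upD [OF assms, of j] by (auto simp: UP_def mem_upD)

lemma zero_skew_UP: "\<zero>\<^bsub>skew_UP R \<tau>\<^esub> = (\<lambda>_. \<zero>)" "\<zero>\<^bsub>skew_UP (UP R) \<rho>\<^esub> = (\<lambda>_ _. \<zero>)"
  by (simp_all add: skew_UP_def UP_def)

lemma up_UP_bound:
  assumes "F \<in> up (UP R)"
  obtains d where "\<And>j i. d < j \<Longrightarrow> F j i = \<zero>" "\<And>j i. d < i \<Longrightarrow> F j i = \<zero>"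
proof -
  from assms obtain d where "bound \<zero>\<^bsub>UP R\<^esub> d F" by (auto simp: up_def)
  then have d: "F j i = \<zero>" if "d < j" for j i
    using that by (auto simp: bound_def UP_def)
  have "\<exists>e. bound \<zero> e (F j)" for j
    using up_UP_coeff(1) [OF assms] by auto
  then obtain e where e: "\<And>j. bound \<zero> (e j) (F j)" by metis
  \<comment> \<open>All rows beyond \<open>d\<close> vanish, so the \<open>x\<close>-degrees of the
    finitely many rows up to \<open>d\<close> suffice for a bound in \<open>i\<close>; including
    \<open>d\<close> itself lets \<open>D\<close> bound \<open>j\<close> as well.\<close>
  define D where "D = Max (insert d (e ` {..d}))"
  have "F j i = \<zero>" if "D < i" for j i
  proof (cases "d < j")
    case False
    then have "e j \<le> D" unfolding D_def by (intro Max_ge) auto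
    with that e [of j] show ?thesis by (auto simp: bound_def)
  qed (simp add: d)
  moreover have "d \<le> D" unfolding D_def by (intro Max_ge) auto
  ultimately show thesis using d by (intro that [of D]) auto
qed

end

section \<open>The ring \<open>R[x][y;\<tau>]\<close> and its subring of elements constant in
  \<open>x\<close>\<close>

context ring_endo
begin

text \<open>Makes the facts about skew polynomials available a second time, with coefficients in
  \<open>R[x]\<close>.\<close>

lemma ring_endo_UP: "ring_endo (UP R) (UP_map \<tau>)"
proof (rule ring_endo.intro [OF _ UP_map_hom])
  interpret U: UP_ring R "UP R" by unfold_locales
  show "ring (UP R)" by (rule U.UP_ring)
qed

text \<open>Since \<open>x\<close> is central, moving a coefficient of \<open>G\<close> past
  \<open>x^i y^j\<close> twists it by \<open>\<tau>^j\<close> alone. A single sum over a box of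
  exponent pairs is the form in which both directions compare products.\<close>

lemma skew_UP_UP_mult:
  assumes F: "F \<in> up (UP R)" and G: "G \<in> up (UP R)"
  shows "(F \<otimes>\<^bsub>skew_UP (UP R) (UP_map \<tau>)\<^esub> G) s m =
    (\<Oplus>z\<in>{..s} \<times> {..m}. case z of (j, i) \<Rightarrow> F j i \<otimes> (\<tau> ^^ j) (G (s - j) (m - i)))"
proof -
  interpret W: ring_endo "UP R" "UP_map \<tau>" by (rule ring_endo_UP)
  have map: "UP_map (\<tau> ^^ j) (G k) \<in> up R" for j k
    using W.tau_pow_closed [of "G k" j] up_UP_coeff(1) [OF G, of k]
    by (simp add: UP_map_funpow UP_proj)
  have mult: "(p \<otimes>\<^bsub>UP R\<^esub> q) = (\<lambda>n. \<Oplus>i\<in>{..n}. p i \<otimes> q (n - i))" if "p \<in> up R" "q \<in> up R" for p q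
    using that by (simp add: UP_def)
  have "F j \<otimes>\<^bsub>UP R\<^esub> UP_map (\<tau> ^^ j) (G (s - j)) \<in> up R" for j
    using W.m_closed [of "F j"] up_UP_coeff(1) [OF F] map by (simp add: UP_proj)
  then have "(F \<otimes>\<^bsub>skew_UP (UP R) (UP_map \<tau>)\<^esub> G) s m =
    (\<Oplus>j\<in>{..s}. (F j \<otimes>\<^bsub>UP R\<^esub> UP_map (\<tau> ^^ j) (G (s - j))) m)"
    using F G by (simp add: W.skew_mult_eq UP_map_funpow UP_finsum_apply)
  also have "\<dots> = (\<Oplus>j\<in>{..s}. \<Oplus>i\<in>{..m}. F j i \<otimes> (\<tau> ^^ j) (G (s - j) (m - i)))"
    using up_UP_coeff [OF F] map by (simp add: mult UP_map_def)
  also have "\<dots> = (\<Oplus>z\<in>{..s} \<times> {..m}. case z of (j, i) \<Rightarrow> F j i \<otimes> (\<tau> ^^ j) (G (s - j) (m - i)))"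
    using up_UP_coeff [OF F] up_UP_coeff [OF G] by (intro finsum_Sigma) auto
  finally show ?thesis .
qed

lemma symmetric_skew_UP_of_UP:
  assumes "symmetric_ring (skew_UP (UP R) (UP_map \<tau>))"
  shows "symmetric_ring (skew_UP R \<tau>)"
proof (rule symmetric_ring_residual [OF skew_UP_ring assms])
  interpret W: ring_endo "UP R" "UP_map \<tau>" by (rule ring_endo_UP)
  \<comment> \<open>The inclusion of \<open>R[y;\<tau>]\<close>: the coefficient of
    \<open>y^j\<close> is placed at \<open>x^0 y^j\<close>.\<close>
  define \<iota> :: "(nat \<Rightarrow> 'a) \<Rightarrow> nat \<Rightarrow> nat \<Rightarrow> 'a" where "\<iota> = (\<lambda>p j i. if i = 0 then p j else \<zero>)"
  have closed: "\<iota> p \<in> up (UP R)" if p: "p \<in> up R" for p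
  proof
    from p obtain n where "bound \<zero> n p" by fast
    then have "bound \<zero>\<^bsub>UP R\<^esub> n (\<iota> p)" by (auto simp: \<iota>_def UP_def bound_def)
    then show "\<exists>n. bound \<zero>\<^bsub>UP R\<^esub> n (\<iota> p)" ..
    have "bound \<zero> 0 (\<iota> p j)" for j by (auto simp: \<iota>_def)
    then show "\<iota> p j \<in> carrier (UP R)" for j
      using p by (auto simp: UP_proj \<iota>_def mem_upD intro!: mem_upI)
  qed
  have mult: "\<iota> (p \<otimes>\<^bsub>skew_UP R \<tau>\<^esub> q) = \<iota> p \<otimes>\<^bsub>skew_UP (UP R) (UP_map \<tau>)\<^esub> \<iota> q"
    if p: "p \<in> up R" and q: "q \<in> up R" for p q
  proof (intro ext)
    fix s m
    have "(\<iota> p \<otimes>\<^bsub>skew_UP (UP R) (UP_map \<tau>)\<^esub> \<iota> q) s m =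
      (\<Oplus>z\<in>{..s} \<times> {..m}. case z of (j, i) \<Rightarrow> \<iota> p j i \<otimes> (\<tau> ^^ j) (\<iota> q (s - j) (m - i)))"
      by (rule skew_UP_UP_mult) (simp_all add: closed p q)
    also have "\<dots> = (\<Oplus>j\<in>{..s}. \<Oplus>i\<in>{..m}. \<iota> p j i \<otimes> (\<tau> ^^ j) (\<iota> q (s - j) (m - i)))"
      using p q by (intro finsum_Sigma [symmetric]) (auto simp: \<iota>_def mem_upD)
    \<comment> \<open>For \<open>m > 0\<close> the exponents \<open>i\<close> and
      \<open>m - i\<close> are never both zero, so each term has a vanishing factor.\<close>
    also have "\<dots> = (\<Oplus>j\<in>{..s}. if m = 0 then p j \<otimes> (\<tau> ^^ j) (q (s - j)) else \<zero>)"
    proof (intro finsum_cong')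
      fix j
      show "(\<Oplus>i\<in>{..m}. \<iota> p j i \<otimes> (\<tau> ^^ j) (\<iota> q (s - j) (m - i))) =
        (if m = 0 then p j \<otimes> (\<tau> ^^ j) (q (s - j)) else \<zero>)"
        using p q by (cases "m = 0") (auto simp: \<iota>_def mem_upD intro!: add.finprod_one_eqI)
    qed (use p q in \<open>auto simp: mem_upD\<close>)
    also have "\<dots> = \<iota> (p \<otimes>\<^bsub>skew_UP R \<tau>\<^esub> q) s m"
      using p q by (simp add: skew_mult_eq \<iota>_def)
    finally show "\<iota> (p \<otimes>\<^bsub>skew_UP R \<tau>\<^esub> q) s m =
      (\<iota> p \<otimes>\<^bsub>skew_UP (UP R) (UP_map \<tau>)\<^esub> \<iota> q) s m" by simp
  qed
  have zero: "\<iota> p = \<zero>\<^bsub>skew_UP (UP R) (UP_map \<tau>)\<^esub> \<longleftrightarrow> p = \<zero>\<^bsub>skew_UP R \<tau>\<^esub>" for p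
    unfolding zero_skew_UP \<iota>_def by (auto simp: fun_eq_iff)
  fix x
  show "\<exists>\<phi>\<in>carrier (skew_UP R \<tau>) \<rightarrow> carrier (skew_UP (UP R) (UP_map \<tau>)).
      (\<forall>a\<in>carrier (skew_UP R \<tau>). \<forall>b\<in>carrier (skew_UP R \<tau>).
        \<phi> (a \<otimes>\<^bsub>skew_UP R \<tau>\<^esub> b) = \<phi> a \<otimes>\<^bsub>skew_UP (UP R) (UP_map \<tau>)\<^esub> \<phi> b) \<and>
      \<phi> \<zero>\<^bsub>skew_UP R \<tau>\<^esub> = \<zero>\<^bsub>skew_UP (UP R) (UP_map \<tau>)\<^esub> \<and>
      (\<phi> x = \<zero>\<^bsub>skew_UP (UP R) (UP_map \<tau>)\<^esub> \<longrightarrow> x = \<zero>\<^bsub>skew_UP R \<tau>\<^esub>)"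
    by (rule bexI [of _ \<iota>])
      (simp_all del: skew_UP_simps(3) W.skew_UP_simps(3) add: zero closed mult Pi_def)
qed

end

section \<open>The substitution of \<open>y^N\<close> for \<open>x\<close>\<close>

text \<open>The image under \<open>x \<mapsto> y\<^sup>N\<close> of an element of \<open>R[x][y;\<tau>]\<close>; \<open>F j i\<close> is the coefficient of \<open>x\<^sup>i y\<^sup>j\<close>.\<close>

definition subst_power :: "('a, 'm) ring_scheme \<Rightarrow> nat \<Rightarrow> (nat \<Rightarrow> nat \<Rightarrow> 'a) \<Rightarrow> nat \<Rightarrow> 'a"
  where "subst_power R N F n = (\<Oplus>\<^bsub>R\<^esub>z\<in>{(j, i). j + N * i = n}. case z of (j, i) \<Rightarrow> F j i)"

text \<open>For \<open>N = 0\<close> the exponent \<open>i\<close> would be unconstrained, and the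
  sum over the infinite set in \<open>subst_power\<close> would take its default value zero.\<close>

lemma finite_add_mult_eq:
  fixes N :: nat
  assumes "0 < N"
  shows "finite {(j, i). j + N * i = n}"
proof (rule finite_subset)
  have "i \<le> N * i" for i using assms by simp
  then show "{(j, i). j + N * i = n} \<subseteq> {..n} \<times> {..n}"
    by (auto intro: order_trans [OF _ le_add2])
qed simp

context ring_endo
begin

lemma subst_power_closed:
  assumes F: "F \<in> up (UP R)"
  shows "subst_power R N F \<in> up R"
proof
  show "subst_power R N F n \<in> carrier R" for n
    unfolding subst_power_def using up_UP_coeff [OF F] by (auto intro!: finsum_closed)
  obtain d where d: "\<And>j i. d < j \<Longrightarrow> F j i = \<zero>" "\<And>j i. d < i \<Longrightarrow> F j i = \<zero>"
    using up_UP_bound [OF F] by metis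
  \<comment> \<open>An exponent above \<open>d + N * d\<close> forces \<open>j\<close> or
    \<open>i\<close> out of the range where \<open>F\<close> can be nonzero.\<close>
  have "F j i = \<zero>" if "d + N * d < j + N * i" for j i
  proof (cases "d < j \<or> d < i")
    case False
    then have "j + N * i \<le> d + N * d" by (intro add_mono mult_le_mono) auto
    with that show ?thesis by simp
  qed (use d in auto)
  then have "bound \<zero> (d + N * d) (subst_power R N F)"
    by (auto simp: subst_power_def intro!: add.finprod_one_eqI)
  then show "\<exists>n. bound \<zero> n (subst_power R N F)" ..
qed

text \<open>On the right a coefficient of \<open>G\<close> is moved past \<open>y^(j + N i)\<close>,
  on the left past \<open>x^i y^j\<close>. By periodicity both twist it by \<open>\<tau>^j\<close>,
  so the two sides add up the same terms in different orders.\<close>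

lemma subst_power_mult:
  assumes F: "F \<in> up (UP R)" and G: "G \<in> up (UP R)" and "0 < N"
    and period: "\<And>a. a \<in> carrier R \<Longrightarrow> (\<tau> ^^ N) a = a"
  shows "subst_power R N (F \<otimes>\<^bsub>skew_UP (UP R) (UP_map \<tau>)\<^esub> G) =
    subst_power R N F \<otimes>\<^bsub>skew_UP R \<tau>\<^esub> subst_power R N G"
proof
  fix n
  define L where "L n = {(j, i). j + N * i = n}" for n
  have fin: "finite (L n)" for n using \<open>0 < N\<close> by (simp add: L_def finite_add_mult_eq)
  have FG [simp]: "F j i \<in> carrier R" "G j i \<in> carrier R" for i j
    using F G by (simp_all add: up_UP_coeff)
  have period': "(\<tau> ^^ (j + N * i)) a = (\<tau> ^^ j) a" if "a \<in> carrier R" for j i a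
  proof (induction i)
    case (Suc i)
    have "j + N * Suc i = j + N * i + N" by simp
    then have "(\<tau> ^^ (j + N * Suc i)) a = (\<tau> ^^ (j + N * i)) ((\<tau> ^^ N) a)"
      by (simp only: funpow_add comp_apply)
    with Suc show ?case by (simp add: period that)
  qed simp
  \<comment> \<open>\<open>A\<close> lists the terms by the monomial \<open>(s, m)\<close> of the
    product and then that of the left factor; \<open>B\<close> lists them by the degree
    \<open>a\<close> of the left factor's image and then the monomials of both factors. The map
    \<open>h\<close> adds the exponents.\<close>
  define A where "A = Sigma (L n) (\<lambda>(s, m). {..s} \<times> {..m})"
  define B where "B = Sigma {..n} (\<lambda>a. L a \<times> L (n - a))"
  define f where "f = (\<lambda>((s, m), (j, i)). F j i \<otimes> (\<tau> ^^ j) (G (s - j) (m - i)))"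
  define h :: "nat \<times> (nat \<times> nat) \<times> (nat \<times> nat) \<Rightarrow> (nat \<times> nat) \<times> (nat \<times> nat)"
    where "h = (\<lambda>(a, (j, i), (l, k)). ((j + l, i + k), (j, i)))"
  have "bij_betw h B A"
    unfolding A_def B_def h_def L_def
  proof (rule bij_betwI [where g = "\<lambda>((s, m), (j, i)). (j + N * i, (j, i), (s - j, m - i))"])
    \<comment> \<open>Inside the box the truncated subtractions are exact, so the inverse of
      \<open>h\<close> lands in \<open>B\<close>.\<close>
    have split: "j + N * i \<le> s + N * m \<and> s - j + N * (m - i) = s + N * m - (j + N * i)"
      if "j \<le> s" "i \<le> m" for i j s m
    proof -
      from that obtain l k where "s = j + l" "m = i + k" by (auto simp: le_iff_add)
      then show ?thesis by (simp add: distrib_left)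
    qed
    show "(\<lambda>((s, m), (j, i)). (j + N * i, (j, i), (s - j, m - i)))
      \<in> Sigma {(j, i). j + N * i = n} (\<lambda>(s, m). {..s} \<times> {..m}) \<rightarrow>
        Sigma {..n} (\<lambda>a. {(j, i). j + N * i = a} \<times> {(j, i). j + N * i = n - a})"
      using split by fastforce
  qed (auto simp: distrib_left)
  moreover have "f x \<in> carrier R" for x
    by (auto simp: f_def split: prod.splits)
  ultimately have reindex: "(\<Oplus>x\<in>B. f (h x)) = (\<Oplus>x\<in>A. f x)"
    by (intro finsum_reindex_bij_betw)
  have "subst_power R N (F \<otimes>\<^bsub>skew_UP (UP R) (UP_map \<tau>)\<^esub> G) n =
    (\<Oplus>x\<in>L n. \<Oplus>y\<in>(case x of (s, m) \<Rightarrow> {..s} \<times> {..m}). f (x, y))"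
    unfolding subst_power_def L_def [symmetric]
    by (intro finsum_cong')
       (auto simp: skew_UP_UP_mult [OF F G] f_def split_def intro!: finsum_closed)
  also have "\<dots> = (\<Oplus>x\<in>A. f x)"
    unfolding A_def using fin
    by (subst finsum_Sigma) (auto simp: f_def split_def)
  also have "\<dots> = (\<Oplus>x\<in>B. f (h x))" by (simp add: reindex)
  also have "\<dots> = (\<Oplus>a\<in>{..n}. \<Oplus>x\<in>L a \<times> L (n - a). f (h (a, x)))"
    unfolding B_def using fin
    by (subst finsum_Sigma) (auto simp: f_def h_def split_def)
  also have "\<dots> = (\<Oplus>a\<in>{..n}. subst_power R N F a \<otimes> (\<tau> ^^ a) (subst_power R N G (n - a)))"
  proof (rule finsum_cong')
    fix a
    have "subst_power R N F a \<otimes> (\<tau> ^^ a) (subst_power R N G (n - a)) =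
      (\<Oplus>z\<in>L a. case z of (j, i) \<Rightarrow> F j i) \<otimes> (\<Oplus>y\<in>L (n - a). (\<tau> ^^ a) (case y of (l, k) \<Rightarrow> G l k))"
      unfolding subst_power_def L_def [symmetric]
      by (subst tau_pow_finsum) (auto simp: fin)
    also have "\<dots> = (\<Oplus>z\<in>L a \<times> L (n - a). case z of (x, y) \<Rightarrow> (case x of (j, i) \<Rightarrow> F j i) \<otimes>
      (\<tau> ^^ a) (case y of (l, k) \<Rightarrow> G l k))"
      by (rule finsum_mult_finsum) (auto simp: fin)
    \<comment> \<open>A pair \<open>(j, i)\<close> in \<open>L a\<close> satisfies
      \<open>a = j + N * i\<close>, which reduces the twist \<open>\<tau>^a\<close> to
      \<open>\<tau>^j\<close>.\<close>
    also have "\<dots> = (\<Oplus>x\<in>L a \<times> L (n - a). f (h (a, x)))"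
      by (intro finsum_cong') (auto simp: f_def h_def L_def period')
    finally show "(\<Oplus>x\<in>L a \<times> L (n - a). f (h (a, x))) =
      subst_power R N F a \<otimes> (\<tau> ^^ a) (subst_power R N G (n - a))" by simp
  qed (use mem_upD [OF subst_power_closed [OF F]] mem_upD [OF subst_power_closed [OF G]] in auto)
  also have "\<dots> = (subst_power R N F \<otimes>\<^bsub>skew_UP R \<tau>\<^esub> subst_power R N G) n"
    using F G by (simp add: skew_mult_eq subst_power_closed)
  finally show "subst_power R N (F \<otimes>\<^bsub>skew_UP (UP R) (UP_map \<tau>)\<^esub> G) n =
    (subst_power R N F \<otimes>\<^bsub>skew_UP R \<tau>\<^esub> subst_power R N G) n" .
qed

text \<open>Uniqueness of division by \<open>N\<close> with remainder: among the pairs giving the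
  exponent \<open>j + N * i\<close>, only \<open>(j, i)\<close> has first entry below
  \<open>N\<close>, and \<open>F\<close> vanishes at the others. Thus the substitution loses no
  coefficient of such an \<open>F\<close>.\<close>

lemma subst_power_apply:
  assumes F: "F \<in> up (UP R)" and deg: "\<And>j i. N \<le> j \<Longrightarrow> F j i = \<zero>" and j: "j < N"
  shows "subst_power R N F (j + N * i) = F j i"
proof -
  let ?L = "{(j', i'). j' + N * i' = j + N * i}"
  have "subst_power R N F (j + N * i) = (\<Oplus>x\<in>?L. case x of (j, i) \<Rightarrow> F j i)"
    by (simp add: subst_power_def)
  also have "\<dots> = (\<Oplus>x\<in>?L. if (j, i) = x then case x of (j, i) \<Rightarrow> F j i else \<zero>)"
  proof (rule finsum_cong')
    fix x assume "x \<in> ?L"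
    then obtain j' i' where x: "x = (j', i')" "j' + N * i' = j + N * i" by auto
    show "(case x of (j, i) \<Rightarrow> F j i) = (if (j, i) = x then case x of (j, i) \<Rightarrow> F j i else \<zero>)"
    proof (cases "N \<le> j'")
      case False
      with x(2) j have "j' = j" by (metis mod_less mod_mult_self2 not_le)
      with x j show ?thesis by auto
    qed (use x j deg in auto)
  qed (use up_UP_coeff [OF F] in auto)
  also have "\<dots> = F j i"
    using j up_UP_coeff [OF F] by (subst finsum_singleton) (auto simp: finite_add_mult_eq)
  finally show ?thesis .
qed

text \<open>For a fixed \<open>N\<close> the elements \<open>x\<close> and \<open>y^N\<close> have
  the same image, so injectivity fails in general; choosing \<open>N\<close> separately for each
  \<open>F\<close> gives the separation that \<open>symmetric_ring_residual\<close> asks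
  for.\<close>

lemma symmetric_skew_UP_UP:
  assumes T: "symmetric_ring (skew_UP R \<tau>)"
    and "0 < t" and period: "\<And>a. a \<in> carrier R \<Longrightarrow> (\<tau> ^^ t) a = a"
  shows "symmetric_ring (skew_UP (UP R) (UP_map \<tau>))"
proof -
  interpret W: ring_endo "UP R" "UP_map \<tau>" by (rule ring_endo_UP)
  show ?thesis
  proof (rule symmetric_ring_residual [OF W.skew_UP_ring T])
    fix F assume "F \<in> carrier (skew_UP (UP R) (UP_map \<tau>))"
    then have F: "F \<in> up (UP R)" by simp
    then obtain d where d: "\<And>j i. d < j \<Longrightarrow> F j i = \<zero>" by (metis up_UP_bound)
    \<comment> \<open>A multiple of \<open>t\<close> keeps \<open>\<tau>^N\<close> the identity on
      the carrier, and the factor \<open>Suc d\<close> puts \<open>N\<close> strictly above the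
      \<open>y\<close>-degree of \<open>F\<close>.\<close>
    define N where "N = t * Suc d"
    have N: "0 < N" "d < N" using \<open>0 < t\<close> mult_le_mono1 [of 1 t "Suc d"] by (auto simp: N_def)
    have N_period: "(\<tau> ^^ N) a = a" if "a \<in> carrier R" for a
      using that period unfolding N_def
      by (induction d) (simp_all add: funpow_add)
    have inj: "F = \<zero>\<^bsub>skew_UP (UP R) (UP_map \<tau>)\<^esub>" if "subst_power R N F = \<zero>\<^bsub>skew_UP R \<tau>\<^esub>"
    proof -
      have "F j i = \<zero>" for j i
      proof (cases "j < N")
        case True
        with subst_power_apply [OF F, of N j i] d N that show ?thesis
          by (simp add: zero_skew_UP del: skew_UP_simps)
      qed (use d N in auto)
      then show ?thesis by (simp add: zero_skew_UP fun_eq_iff del: W.skew_UP_simps)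
    qed
    have zero: "subst_power R N \<zero>\<^bsub>skew_UP (UP R) (UP_map \<tau>)\<^esub> = \<zero>\<^bsub>skew_UP R \<tau>\<^esub>"
      unfolding zero_skew_UP by (auto simp: subst_power_def split_def)
    show "\<exists>\<phi>\<in>carrier (skew_UP (UP R) (UP_map \<tau>)) \<rightarrow> carrier (skew_UP R \<tau>).
      (\<forall>a\<in>carrier (skew_UP (UP R) (UP_map \<tau>)). \<forall>b\<in>carrier (skew_UP (UP R) (UP_map \<tau>)).
        \<phi> (a \<otimes>\<^bsub>skew_UP (UP R) (UP_map \<tau>)\<^esub> b) = \<phi> a \<otimes>\<^bsub>skew_UP R \<tau>\<^esub> \<phi> b) \<and>
      \<phi> \<zero>\<^bsub>skew_UP (UP R) (UP_map \<tau>)\<^esub> = \<zero>\<^bsub>skew_UP R \<tau>\<^esub> \<and>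
      (\<phi> F = \<zero>\<^bsub>skew_UP R \<tau>\<^esub> \<longrightarrow> F = \<zero>\<^bsub>skew_UP (UP R) (UP_map \<tau>)\<^esub>)"
      using inj zero N N_period
      by (intro bexI [of _ "subst_power R N"])
        (auto simp: subst_power_closed subst_power_mult simp del: skew_UP_simps(3) W.skew_UP_simps(3))
  qed
qed

end

theorem theorem3p1:
  fixes R :: "('a, 'm) ring_scheme" (structure)
    and \<sigma> :: "'a \<Rightarrow> 'a"
  assumes "ring R"
    and "\<sigma> \<in> ring_hom R R"
    and "\<exists>a\<in>carrier R. \<sigma> a \<noteq> \<zero>"
    and "\<exists>a\<in>carrier R. \<sigma> a \<noteq> a"
    and "\<exists>t>0. \<forall>a\<in>carrier R. (\<sigma> ^^ t) a = a"
  shows "strongly_symmetric R \<sigma> \<longleftrightarrow> strongly_symmetric (UP R) (UP_map \<sigma>)"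
proof -
  interpret ring_endo R \<sigma> using assms(1,2) by (rule ring_endo.intro)
  from assms(5) obtain t where "0 < t" "\<And>a. a \<in> carrier R \<Longrightarrow> (\<sigma> ^^ t) a = a" by blast
  then show ?thesis
    unfolding strongly_symmetric_def
    using symmetric_skew_UP_of_UP symmetric_skew_UP_UP by blast
qed

end
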